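(* If quaternion functions $f$ and $\varphi$ are $\mathbb{H}$-differentiable at a point $z^0\in\mathbb{H}$ and $\varphi\neq0$ in a neighborhood of $z^0$, then the functions $f\cdot\frac1\varphi$ and $\frac1\varphi\cdot f$ are also $\mathbb{H}$-differentiable at $z^0$ and $$\left(f\cdot\frac1\varphi\right)'(z^0)=f'(z^0)\cdot\frac{1}{\varphi(z^0)}-f(z^0)\,\frac{1}{\varphi(z^0)}\cdot\varphi'(z^0)\cdot\frac{1}{\varphi(z^0)}$$ and $$\left(\frac1\varphi\cdot f\right)'(z^0)=-\frac{1}{\varphi(z^0)}\cdot\varphi'(z^0)\cdot\frac{1}{\varphi(z^0)}\,f(z^0)+\frac{1}{\varphi(z^0)}\cdot f'(z^0).$$
   Context: $\mathbb{H}$ denotes the algebra of real quaternions with its usual norm $|\cdot|$; for a quaternion $q\neq0$, $\frac1q=q^{-1}$ is its inverse. A quaternion function $f$ defined on a neighborhood $G\subset\mathbb{H}$ of a point $z^0$ is called $\mathbb{H}$-differentiable at $z^0$ if there exist two (finite or infinite) sequences of quaternions $A_k=A_k(z^0)$, $B_k=B_k(z^0)$ such that $\sum_k A_kB_k$ is finite (converges) and, for $z^0+h\in G$, $$f(z^0+h)-f(z^0)=\sum_k A_k\, h\, B_k+\omega(z^0,h),\qquad \lim_{h\to0}\frac{|\omega(z^0,h)|}{|h|}=0.$$ In this case the quaternion $f'(z^0)=\sum_k A_kB_k$ is called the $\mathbb{H}$-derivative of $f$ at $z^0$. *)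

theory Defs
  imports "HOL-Analysis.Analysis"
begin

section \<open>The normed division algebra of real quaternions\<close>

text \<open>\<open>Quat a b c d\<close> stands for \<open>a + b i + c j + d k\<close>.\<close>

datatype quat = Quat (qRe: real) (qI: real) (qJ: real) (qK: real)

lemma quat_eq_iff: "x = y \<longleftrightarrow> qRe x = qRe y \<and> qI x = qI y \<and> qJ x = qJ y \<and> qK x = qK y"
  by (cases x; cases y) simp

instantiation quat :: ab_group_add
begin

definition "0 = Quat 0 0 0 0"
definition "x + y = Quat (qRe x + qRe y) (qI x + qI y) (qJ x + qJ y) (qK x + qK y)"
definition "x - y = Quat (qRe x - qRe y) (qI x - qI y) (qJ x - qJ y) (qK x - qK y)"
definition "- x = Quat (- qRe x) (- qI x) (- qJ x) (- qK x)"

instance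
  by standard (simp_all add: zero_quat_def plus_quat_def minus_quat_def uminus_quat_def quat_eq_iff)

end

instantiation quat :: real_vector
begin

definition "r *\<^sub>R x = Quat (r * qRe x) (r * qI x) (r * qJ x) (r * qK x)"

instance
  by standard (simp_all add: scaleR_quat_def plus_quat_def quat_eq_iff algebra_simps)

end

instantiation quat :: ring_1
begin

definition "1 = Quat 1 0 0 0"

definition "x * y = Quat
  (qRe x * qRe y - qI x * qI y - qJ x * qJ y - qK x * qK y)
  (qRe x * qI y + qI x * qRe y + qJ x * qK y - qK x * qJ y)
  (qRe x * qJ y - qI x * qK y + qJ x * qRe y + qK x * qI y)
  (qRe x * qK y + qI x * qJ y - qJ x * qI y + qK x * qRe y)"

instance
  by standard
    (simp_all add: zero_quat_def one_quat_def plus_quat_def times_quat_def quat_eq_iff algebra_simps)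

end

instantiation quat :: real_inner
begin

definition "x \<bullet> y = qRe x * qRe y + qI x * qI y + qJ x * qJ y + qK x * qK y"
definition "norm x = sqrt ((qRe x)\<^sup>2 + (qI x)\<^sup>2 + (qJ x)\<^sup>2 + (qK x)\<^sup>2)"
definition "sgn x = x /\<^sub>R norm x" for x :: quat
definition "dist x y = norm (x - y)" for x y :: quat
definition [code del]:
  "(uniformity :: (quat \<times> quat) filter) = (INF e\<in>{0 <..}. principal {(x, y). dist x y < e})"
definition [code del]:
  "open (U :: quat set) \<longleftrightarrow> (\<forall>x\<in>U. eventually (\<lambda>(x', y). x' = x \<longrightarrow> y \<in> U) uniformity)"

instance
proof
  fix x y z :: quat and r :: real
  show "x \<bullet> y = y \<bullet> x"
    by (simp add: inner_quat_def algebra_simps)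
  show "(x + y) \<bullet> z = x \<bullet> z + y \<bullet> z"
    by (simp add: inner_quat_def plus_quat_def algebra_simps)
  show "(r *\<^sub>R x) \<bullet> y = r * (x \<bullet> y)"
    by (simp add: inner_quat_def scaleR_quat_def algebra_simps)
  show "0 \<le> x \<bullet> x"
    by (simp add: inner_quat_def)
  show "x \<bullet> x = 0 \<longleftrightarrow> x = 0"
  proof
    assume "x \<bullet> x = 0"
    moreover have "0 \<le> qRe x * qRe x" "0 \<le> qI x * qI x" "0 \<le> qJ x * qJ x" "0 \<le> qK x * qK x"
      by simp_all
    ultimately have "qRe x * qRe x = 0" "qI x * qI x = 0" "qJ x * qJ x = 0" "qK x * qK x = 0"
      unfolding inner_quat_def by linarith+
    then show "x = 0"
      by (simp add: zero_quat_def quat_eq_iff)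
  qed (simp add: inner_quat_def zero_quat_def)
  show "norm x = sqrt (x \<bullet> x)"
    by (simp add: norm_quat_def inner_quat_def power2_eq_square)
qed (simp_all only: sgn_quat_def dist_quat_def uniformity_quat_def open_quat_def)

end

lemma quat_norm_mult: "norm (x * y) = norm x * norm y" for x y :: quat
  unfolding norm_quat_def real_sqrt_mult [symmetric]
  by (rule arg_cong [where f = sqrt]) (simp add: times_quat_def power2_eq_square algebra_simps)

instantiation quat :: real_normed_div_algebra
begin

definition "inverse x = Quat (qRe x) (- qI x) (- qJ x) (- qK x) /\<^sub>R (norm x)\<^sup>2"
definition "x div y = x * inverse y" for x y :: quat

instance
proof
  fix x y :: quat and r :: real
  show "r *\<^sub>R x * y = r *\<^sub>R (x * y)" "x * r *\<^sub>R y = r *\<^sub>R (x * y)"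
    by (simp_all add: scaleR_quat_def times_quat_def quat_eq_iff algebra_simps)
  show "norm (x * y) = norm x * norm y"
    by (rule quat_norm_mult)
  have N: "(norm x)\<^sup>2 = qRe x * qRe x + qI x * qI x + qJ x * qJ x + qK x * qK x"
    by (simp add: norm_quat_def power2_eq_square)
  let ?c = "Quat (qRe x) (- qI x) (- qJ x) (- qK x)"
  have c: "?c * x = (norm x)\<^sup>2 *\<^sub>R 1" "x * ?c = (norm x)\<^sup>2 *\<^sub>R 1"
    by (simp_all add: N times_quat_def one_quat_def scaleR_quat_def)
  have l: "(r *\<^sub>R a) * b = r *\<^sub>R (a * b)" and m: "a * (r *\<^sub>R b) = r *\<^sub>R (a * b)" for a b :: quat and r
    by (simp_all add: scaleR_quat_def times_quat_def quat_eq_iff algebra_simps)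
  assume "x \<noteq> 0"
  then have "(norm x)\<^sup>2 \<noteq> 0"
    by simp
  then show "inverse x * x = 1" "x * inverse x = 1"
    by (simp_all add: inverse_quat_def c l m del: power2_eq_iff)
next
  show "inverse (0::quat) = 0"
    by (simp add: inverse_quat_def zero_quat_def scaleR_quat_def)
next
  fix x y :: quat
  show "x div y = x * inverse y"
    by (rule divide_quat_def)
qed

end


section \<open>H-differentiability\<close>

text \<open>
  A function defined on some neighbourhood of \<open>z\<close> is represented by a total function, whose values
  outside the neighbourhood \<open>G\<close> are irrelevant. Finite sequences \<open>A\<close>, \<open>B\<close> are the infinite ones
  that are eventually \<open>0\<close>. The series \<open>\<Sum>k. A k * h * B k\<close> is required to converge, to
  \<open>f (z + h) - f z - \<omega> h\<close>.
\<close>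

definition has_H_derivative :: "(quat \<Rightarrow> quat) \<Rightarrow> quat \<Rightarrow> quat \<Rightarrow> bool" where
  "has_H_derivative f D z \<longleftrightarrow>
    (\<exists>G A B \<omega>. open G \<and> z \<in> G \<and>
      (\<lambda>k. A k * B k) sums D \<and>
      (\<forall>h. z + h \<in> G \<longrightarrow> (\<lambda>k. A k * h * B k) sums (f (z + h) - f z - \<omega> h)) \<and>
      ((\<lambda>h. norm (\<omega> h) / norm h) \<longlongrightarrow> 0) (at 0))"

definition H_differentiable :: "(quat \<Rightarrow> quat) \<Rightarrow> quat \<Rightarrow> bool" where
  "H_differentiable f z \<longleftrightarrow> (\<exists>D. has_H_derivative f D z)"

definition H_deriv :: "(quat \<Rightarrow> quat) \<Rightarrow> quat \<Rightarrow> quat" where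
  "H_deriv f z = (THE D. has_H_derivative f D z)"

lemma has_H_derivative_imp_tendsto:
  assumes "has_H_derivative f D z"
  shows "((\<lambda>t. (f (z + of_real t) - f z) /\<^sub>R t) \<longlongrightarrow> D) (at (0::real))"
proof -
  obtain G A B \<omega> where G: "open G" "z \<in> G" and D: "(\<lambda>k. A k * B k) sums D"
    and S: "\<And>h. z + h \<in> G \<Longrightarrow> (\<lambda>k. A k * h * B k) sums (f (z + h) - f z - \<omega> h)"
    and \<omega>: "((\<lambda>h. norm (\<omega> h) / norm h) \<longlongrightarrow> 0) (at 0)"
    using assms unfolding has_H_derivative_def by blast
  have "((\<lambda>t. z + of_real t) \<longlongrightarrow> z + of_real 0) (at (0::real))"
    by (intro tendsto_intros)
  then have ev: "eventually (\<lambda>t. z + of_real t \<in> G) (at (0::real))"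
    using G by (auto intro: topological_tendstoD)
  have "filterlim (of_real :: real \<Rightarrow> quat) (at 0) (at 0)"
    unfolding filterlim_at
    by (auto simp: eventually_at_filter intro!: tendsto_eq_intros)
  from filterlim_compose [OF \<omega> this]
  have "((\<lambda>t. norm (\<omega> (of_real t) /\<^sub>R t)) \<longlongrightarrow> 0) (at (0::real))"
    by (simp add: divide_inverse mult.commute)
  then have "((\<lambda>t. D + \<omega> (of_real t) /\<^sub>R t) \<longlongrightarrow> D + 0) (at (0::real))"
    by (intro tendsto_intros) (rule tendsto_norm_zero_cancel)
  moreover have "eventually (\<lambda>t. D + \<omega> (of_real t) /\<^sub>R t = (f (z + of_real t) - f z) /\<^sub>R t) (at (0::real))"
    using ev eventually_neq_at_within [of 0 0 UNIV]
  proof (eventually_elim, goal_cases)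
    case (1 t)
    have "(\<lambda>k. A k * of_real t * B k) = (\<lambda>k. t *\<^sub>R (A k * B k))"
      by (simp add: of_real_def)
    with S [OF 1(1)] have "(\<lambda>k. t *\<^sub>R (A k * B k)) sums (f (z + of_real t) - f z - \<omega> (of_real t))"
      by simp
    from sums_unique2 [OF this sums_scaleR_right [OF D]]
    have "f (z + of_real t) - f z = t *\<^sub>R D + \<omega> (of_real t)"
      by (simp add: algebra_simps)
    with 1 show ?case
      by (simp add: scaleR_add_right)
  qed
  ultimately show ?thesis
    using Lim_transform_eventually by fastforce
qed

lemma has_H_derivative_unique:
  "has_H_derivative f D z \<Longrightarrow> has_H_derivative f E z \<Longrightarrow> D = E"
  by (rule tendsto_unique [OF _ has_H_derivative_imp_tendsto has_H_derivative_imp_tendsto]) auto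

lemma H_deriv_eqI: "has_H_derivative f D z \<Longrightarrow> H_deriv f z = D"
  unfolding H_deriv_def by (blast intro: has_H_derivative_unique)

end

theory Submission
  imports Defs
begin

text \<open>
  \<open>H\<close>-differentiability is Frechet differentiability with a derivative of the form
  \<open>L h = (\<Sum>k. A k * h * B k)\<close>, the \<open>H\<close>-derivative being \<open>L 1\<close>. Maps of this form are closed under
  sums (interleave the two series) and under multiplication by constants on either side, so the
  Frechet rules for products and inverses, evaluated at \<open>1\<close>, give both formulas.
\<close>

text \<open>The coefficients are fixed before \<open>h\<close>, and convergence is demanded on the
  whole space, so the notion mentions neither a base point nor a neighbourhood.\<close>

definition two_sided_series :: "(quat \<Rightarrow> quat) \<Rightarrow> bool" where
  "two_sided_series L \<longleftrightarrow> (\<exists>A B. \<forall>h. (\<lambda>k. A k * h * B k) sums L h)"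

text \<open>Padding each series with zeros at the positions of the other parity does not change its
  sum; the interleaved series is the termwise sum of the two padded ones.\<close>

lemma sums_interleave:
  fixes f g :: "nat \<Rightarrow> 'a :: real_normed_vector"
  assumes "f sums a" "g sums b"
  shows "(\<lambda>n. if even n then f (n div 2) else g (n div 2)) sums (a + b)"
proof -
  have "(\<lambda>n. if even n then f (n div 2) else 0) sums a"
    using sums_mono_reindex [of "\<lambda>k. 2 * k" "\<lambda>n. if even n then f (n div 2) else 0" a] assms(1)
    by (force simp: strict_mono_def elim!: evenE)
  moreover have "(\<lambda>n. if even n then 0 else g (n div 2)) sums b"
    using sums_mono_reindex [of "\<lambda>k. 2 * k + 1" "\<lambda>n. if even n then 0 else g (n div 2)" b] assms(2)
    by (force simp: strict_mono_def elim!: oddE)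
  ultimately have "(\<lambda>n. (if even n then f (n div 2) else 0) + (if even n then 0 else g (n div 2)))
      sums (a + b)"
    by (rule sums_add)
  then show ?thesis
    by (simp add: if_distrib [where f = "\<lambda>x. x + _"] cong: if_cong)
qed

lemma two_sided_series_add:
  assumes "two_sided_series L" "two_sided_series M"
  shows "two_sided_series (\<lambda>h. L h + M h)"
proof -
  obtain A B where L: "\<And>h. (\<lambda>k. A k * h * B k) sums L h"
    using assms(1) unfolding two_sided_series_def by blast
  obtain C E where M: "\<And>h. (\<lambda>k. C k * h * E k) sums M h"
    using assms(2) unfolding two_sided_series_def by blast
  let ?A = "\<lambda>n. if even n then A (n div 2) else C (n div 2)"
  let ?B = "\<lambda>n. if even n then B (n div 2) else E (n div 2)"
  have "(\<lambda>k. ?A k * h * ?B k) = (\<lambda>n. if even n then A (n div 2) * h * B (n div 2)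
      else C (n div 2) * h * E (n div 2))" for h
    by auto
  then have "(\<lambda>k. ?A k * h * ?B k) sums (L h + M h)" for h
    using sums_interleave [OF L M] by simp
  then show ?thesis
    unfolding two_sided_series_def by (intro exI allI)
qed

lemma two_sided_series_mult:
  assumes "two_sided_series L"
  shows "two_sided_series (\<lambda>h. a * L h * b)"
proof -
  obtain A B where L: "\<And>h. (\<lambda>k. A k * h * B k) sums L h"
    using assms unfolding two_sided_series_def by blast
  \<comment> \<open>By associativity the outer constants are absorbed into the coefficients, each on
    its own side of \<open>h\<close>.\<close>
  have "(\<lambda>k. (a * A k) * h * (B k * b)) sums (a * L h * b)" for h
    using sums_mult2 [OF sums_mult [OF L]] by (simp add: mult.assoc)
  then show ?thesis
    unfolding two_sided_series_def by (intro exI allI)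
qed

lemma two_sided_series_mult_left: "two_sided_series L \<Longrightarrow> two_sided_series (\<lambda>h. a * L h)"
  using two_sided_series_mult [of L a 1] by simp

lemma two_sided_series_mult_right: "two_sided_series L \<Longrightarrow> two_sided_series (\<lambda>h. L h * b)"
  using two_sided_series_mult [of L 1 b] by simp

lemma two_sided_series_minus: "two_sided_series L \<Longrightarrow> two_sided_series (\<lambda>h. - L h)"
  using two_sided_series_mult [of L "- 1" 1] by simp

text \<open>Finite dimension is the reason: each of the four coordinates of \<open>h\<close> is at
  most \<open>norm h\<close> in absolute value, so the norms of the images of 1, i, j, k add up to a
  bound.\<close>

lemma linear_quat_imp_bounded_linear:
  fixes L :: "quat \<Rightarrow> 'a :: real_normed_vector"
  assumes "linear L"
  shows "bounded_linear L"
proof -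
  interpret linear L by fact
  have h: "h = qRe h *\<^sub>R Quat 1 0 0 0 + qI h *\<^sub>R Quat 0 1 0 0 + qJ h *\<^sub>R Quat 0 0 1 0
      + qK h *\<^sub>R Quat 0 0 0 1" for h
    by (simp add: quat_eq_iff plus_quat_def scaleR_quat_def)
  have comp: "\<bar>qRe h\<bar> \<le> norm h" "\<bar>qI h\<bar> \<le> norm h" "\<bar>qJ h\<bar> \<le> norm h" "\<bar>qK h\<bar> \<le> norm h" for h
    unfolding norm_quat_def by (rule real_le_rsqrt, simp)+
  show ?thesis
  proof
    let ?K = "norm (L (Quat 1 0 0 0)) + norm (L (Quat 0 1 0 0)) + norm (L (Quat 0 0 1 0))
      + norm (L (Quat 0 0 0 1))"
    have "norm (L h) \<le> norm h * ?K" for h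
    proof -
      have "norm (L h) = norm (qRe h *\<^sub>R L (Quat 1 0 0 0) + qI h *\<^sub>R L (Quat 0 1 0 0)
          + qJ h *\<^sub>R L (Quat 0 0 1 0) + qK h *\<^sub>R L (Quat 0 0 0 1))"
        by (subst h) (simp only: add scaleR)
      also have "\<dots> \<le> \<bar>qRe h\<bar> * norm (L (Quat 1 0 0 0)) + \<bar>qI h\<bar> * norm (L (Quat 0 1 0 0))
          + \<bar>qJ h\<bar> * norm (L (Quat 0 0 1 0)) + \<bar>qK h\<bar> * norm (L (Quat 0 0 0 1))"
        by (intro norm_triangle_le add_mono) simp_all
      also have "\<dots> \<le> norm h * ?K"
        unfolding distrib_left by (intro add_mono mult_right_mono comp) simp_all
      finally show ?thesis .
    qed
    then show "\<exists>K. \<forall>h. norm (L h) \<le> norm h * K"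
      by blast
  qed
qed

text \<open>Each term is real-linear in \<open>h\<close>, and linearity passes to the pointwise sum.
  Boundedness then comes from finite dimension, without any estimate on the coefficients.\<close>

lemma two_sided_series_imp_bounded_linear:
  assumes "two_sided_series L"
  shows "bounded_linear L"
proof (rule linear_quat_imp_bounded_linear, rule linearI)
  obtain A B where L: "\<And>h. (\<lambda>k. A k * h * B k) sums L h"
    using assms unfolding two_sided_series_def by blast
  show "L (x + y) = L x + L y" for x y
    using sums_unique2 [OF L [of "x + y"]] sums_add [OF L [of x] L [of y]]
    by (simp add: algebra_simps)
  show "L (r *\<^sub>R x) = r *\<^sub>R L x" for r x
    using sums_unique2 [OF L [of "r *\<^sub>R x"]] sums_scaleR_right [OF L [of x], of r]
    by simp
qed

text \<open>
  The series in the definition of \<open>has_H_derivative\<close> is only assumed to converge for small \<open>h\<close>;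
  by homogeneity it then converges for every \<open>h\<close>.
\<close>

lemma has_H_derivative_iff_has_derivative:
  "has_H_derivative f D z \<longleftrightarrow> (\<exists>L. two_sided_series L \<and> L 1 = D \<and> (f has_derivative L) (at z))"
proof
  assume "has_H_derivative f D z"
  then obtain G A B \<omega> where G: "open G" "z \<in> G" and D: "(\<lambda>k. A k * B k) sums D"
    and S: "\<And>h. z + h \<in> G \<Longrightarrow> (\<lambda>k. A k * h * B k) sums (f (z + h) - f z - \<omega> h)"
    and \<omega>: "((\<lambda>h. norm (\<omega> h) / norm h) \<longlongrightarrow> 0) (at 0)"
    unfolding has_H_derivative_def by blast
  define L where "L h = (\<Sum>k. A k * h * B k)" for h
  have L: "(\<lambda>k. A k * h * B k) sums L h" for h
  proof -
    have "((\<lambda>t. z + t *\<^sub>R h) \<longlongrightarrow> z + 0 *\<^sub>R h) (at (0::real))"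
      by (intro tendsto_intros)
    then have "eventually (\<lambda>t. z + t *\<^sub>R h \<in> G \<and> t \<noteq> 0) (at (0::real))"
      using G eventually_neq_at_within [of 0 0 UNIV]
      by (auto intro: topological_tendstoD eventually_conj)
    then obtain t :: real where t: "z + t *\<^sub>R h \<in> G" "t \<noteq> 0"
      using eventually_happens by force
    have "summable (\<lambda>k. inverse t *\<^sub>R (A k * (t *\<^sub>R h) * B k))"
      using sums_summable [OF S [OF t(1)]] by (rule summable_scaleR_right)
    then show ?thesis
      using t(2) unfolding L_def by (simp add: summable_sums)
  qed
  then have series: "two_sided_series L"
    unfolding two_sided_series_def by blast
  have "((\<lambda>h. z + h) \<longlongrightarrow> z + 0) (at 0)"
    by (intro tendsto_intros)
  then have "eventually (\<lambda>h. z + h \<in> G) (at 0)"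
    using G by (auto intro: topological_tendstoD)
  \<comment> \<open>The given \<open>\<omega>\<close> is tied to \<open>f\<close> only where
    \<open>z + h\<close> lies in \<open>G\<close>; there it is the Frechet remainder of
    \<open>L\<close>, which is enough for the limit at 0.\<close>
  then have "eventually (\<lambda>h. norm (\<omega> h) / norm h = norm (f (z + h) - f z - L h) / norm h) (at 0)"
  proof eventually_elim
    case (elim h)
    have "L h = f (z + h) - f z - \<omega> h"
      by (rule sums_unique2 [OF L S [OF elim]])
    then show ?case
      by simp
  qed
  with \<omega> have "((\<lambda>h. norm (f (z + h) - f z - L h) / norm h) \<longlongrightarrow> 0) (at 0)"
    by (rule Lim_transform_eventually)
  then have "(f has_derivative L) (at z)"
    unfolding has_derivative_at using two_sided_series_imp_bounded_linear [OF series] by simp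
  moreover have "L 1 = D"
    using sums_unique2 [OF L [of 1]] D by simp
  ultimately show "\<exists>L. two_sided_series L \<and> L 1 = D \<and> (f has_derivative L) (at z)"
    using series by blast
next
  assume "\<exists>L. two_sided_series L \<and> L 1 = D \<and> (f has_derivative L) (at z)"
  then obtain L A B where L: "\<And>h. (\<lambda>k. A k * h * B k) sums L h"
    and "L 1 = D" and f: "(f has_derivative L) (at z)"
    unfolding two_sided_series_def by blast
  show "has_H_derivative f D z"
    unfolding has_H_derivative_def
  proof (intro exI conjI allI impI)
    \<comment> \<open>With \<open>\<omega>\<close> chosen as the Frechet remainder of
      \<open>L\<close>, the expansion holds for every \<open>h\<close>, so the whole space serves as
      neighbourhood.\<close>
    show "open (UNIV :: quat set)" "z \<in> UNIV"
      by simp_all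
    show "(\<lambda>k. A k * B k) sums D"
      using L [of 1] \<open>L 1 = D\<close> by simp
    show "(\<lambda>k. A k * h * B k) sums (f (z + h) - f z - (f (z + h) - f z - L h))" for h
      using L by simp
    show "((\<lambda>h. norm (f (z + h) - f z - L h) / norm h) \<longlongrightarrow> 0) (at 0)"
      using f unfolding has_derivative_at by blast
  qed
qed

lemma has_H_derivative_mult:
  assumes "has_H_derivative f D z" "has_H_derivative g E z"
  shows "has_H_derivative (\<lambda>x. f x * g x) (f z * E + D * g z) z"
proof -
  obtain L M where L: "two_sided_series L" "L 1 = D" "(f has_derivative L) (at z)"
    and M: "two_sided_series M" "M 1 = E" "(g has_derivative M) (at z)"
    using assms unfolding has_H_derivative_iff_has_derivative by blast
  have "two_sided_series (\<lambda>h. f z * M h + L h * g z)"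
    by (intro two_sided_series_add two_sided_series_mult_left two_sided_series_mult_right L M)
  with has_derivative_mult [OF L(3) M(3)] L(2) M(2) show ?thesis
    unfolding has_H_derivative_iff_has_derivative by blast
qed

text \<open>In a noncommutative division algebra the Frechet derivative of the inverse is
  \<open>M\<close> placed between two factors \<open>inverse (g z)\<close>, with a minus sign;
  constants on both sides keep the series form.\<close>

lemma has_H_derivative_inverse:
  assumes "has_H_derivative g E z" "g z \<noteq> 0"
  shows "has_H_derivative (\<lambda>x. inverse (g x)) (- (inverse (g z) * E * inverse (g z))) z"
proof -
  obtain M where M: "two_sided_series M" "M 1 = E" "(g has_derivative M) (at z)"
    using assms unfolding has_H_derivative_iff_has_derivative by blast
  have "two_sided_series (\<lambda>h. - (inverse (g z) * M h * inverse (g z)))"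
    by (intro two_sided_series_minus two_sided_series_mult M)
  with Deriv.has_derivative_inverse [OF assms(2) M(3)] M(2) show ?thesis
    unfolding has_H_derivative_iff_has_derivative by blast
qed

theorem corollary3p8:
  fixes f \<phi> :: "quat \<Rightarrow> quat" and z :: quat
  assumes "H_differentiable f z"
    and "H_differentiable \<phi> z"
    and "\<forall>\<^sub>F x in nhds z. \<phi> x \<noteq> 0"
  shows "H_differentiable (\<lambda>x. f x * inverse (\<phi> x)) z \<and>
    H_differentiable (\<lambda>x. inverse (\<phi> x) * f x) z \<and>
    H_deriv (\<lambda>x. f x * inverse (\<phi> x)) z =
      H_deriv f z * inverse (\<phi> z) - f z * inverse (\<phi> z) * H_deriv \<phi> z * inverse (\<phi> z) \<and>
    H_deriv (\<lambda>x. inverse (\<phi> x) * f x) z =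
      - (inverse (\<phi> z) * H_deriv \<phi> z * inverse (\<phi> z) * f z) + inverse (\<phi> z) * H_deriv f z"
proof -
  obtain D E where f: "has_H_derivative f D z" and \<phi>: "has_H_derivative \<phi> E z"
    using assms(1,2) unfolding H_differentiable_def by blast
  \<comment> \<open>The filter \<open>nhds z\<close> is not punctured, so the hypothesis covers
    \<open>z\<close> itself.\<close>
  have "\<phi> z \<noteq> 0"
    using assms(3) by (rule eventually_nhds_x_imp_x)
  note inv = has_H_derivative_inverse [OF \<phi> this]
  \<comment> \<open>The two quotients are the two orders of the product of \<open>f\<close> and the
    inverse of \<open>\<phi>\<close>; uniqueness of the derivative then turns these facts into
    equations for \<open>H_deriv\<close>.\<close>
  note r = has_H_derivative_mult [OF f inv] and l = has_H_derivative_mult [OF inv f]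
  show ?thesis
    using r l unfolding H_deriv_eqI [OF r] H_deriv_eqI [OF l] H_deriv_eqI [OF f] H_deriv_eqI [OF \<phi>]
    by (auto simp: H_differentiable_def algebra_simps)
qed

end
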